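(* Let $q_0$ be a real number with $q_0 \ge 19$, and let $\mathscr{P} = \{p \text{ prime} : p > q_0\}$, regarded as a multiplicative base. Then $\mathscr{P}$ does not factorize a covering. That is, there do not exist a finite set $S \subset \mathbb{N}_{>1}$ of (distinct) moduli, each of which is factorized by $\mathscr{P}$ (i.e. each $m \in S$ has all its prime factors $> q_0$), and integers $a_m$ ($m \in S$) such that $\mathbb{Z} = \bigcup_{m \in S} \{x \in \mathbb{Z} : x \equiv a_m \pmod m\}$.
   Context: $\mathbb{N}_{>1}$ is the set of integers greater than $1$. A residue system is a collection $C = \{a_m \bmod m\}_{m \in S}$ of residue classes with $S \subset \mathbb{N}_{>1}$ a finite set of moduli (moduli are not repeated: exactly one residue class for each $m\in S$). It is a covering system if the union of its residue classes is $\mathbb{Z}$. A (multiplicative) base is a set $\mathscr{P} \subset \mathbb{N}_{>1}$ of pairwise coprime integers. A base $\mathscr{P}$ factorizes an integer $m$ if $m$ is a finite product of powers (with non-negative integer exponents) of elements of $\mathscr{P}$. $\mathscr{P}$ factorizes a covering if there is a covering system all of whose moduli are factorized by $\mathscr{P}$. *)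

theory Defs
  imports Complex_Main "HOL-Number_Theory.Number_Theory"
begin

definition residue_class :: "int \<Rightarrow> nat \<Rightarrow> int set" where
  "residue_class a m = {x. [x = a] (mod int m)}"

(* The system {a m mod m : m in S} is given by its set of moduli S and a choice of residues a;
   only the values of a on S matter.  Moduli are distinct because S is a set. *)
definition residue_system :: "nat set \<Rightarrow> (nat \<Rightarrow> int) \<Rightarrow> bool" where
  "residue_system S a \<longleftrightarrow> finite S \<and> (\<forall>m\<in>S. 1 < m)"

definition covering_system :: "nat set \<Rightarrow> (nat \<Rightarrow> int) \<Rightarrow> bool" where
  "covering_system S a \<longleftrightarrow> residue_system S a \<and> (\<Union>m\<in>S. residue_class (a m) m) = UNIV"

definition mult_base :: "nat set \<Rightarrow> bool" where
  "mult_base P \<longleftrightarrow> (\<forall>b\<in>P. 1 < b) \<and> pairwise coprime P"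

(* The two notions below are meant for bases P, but make sense for every set P. *)
definition factorizes :: "nat set \<Rightarrow> nat \<Rightarrow> bool" where
  "factorizes P m \<longleftrightarrow> (\<exists>F e. finite F \<and> F \<subseteq> P \<and> m = (\<Prod>b\<in>F. b ^ e b))"

definition factorizes_covering :: "nat set \<Rightarrow> bool" where
  "factorizes_covering P \<longleftrightarrow> (\<exists>S a. covering_system S a \<and> (\<forall>m\<in>S. factorizes P m))"

lemma mult_base_primes:
  assumes "\<forall>p\<in>P. prime p"
  shows "mult_base P"
proof -
  have "1 < b" if "b \<in> P" for b
    using assms that by (simp add: prime_gt_1_nat del: One_nat_def)
  moreover have "coprime b c" if "b \<in> P" "c \<in> P" "b \<noteq> c" for b c
    using assms that by (simp add: primes_coprime)
  ultimately show ?thesis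
    by (simp add: mult_base_def pairwise_def)
qed

end

theory Submission
  imports Defs "HOL-Library.Indicator_Function" "HOL-Library.Infinite_Set"
begin

text \<open>
  The proof is the distortion method of Balister, Bollobas, Morris, Sahasrabudhe and Tiba. Let
  \<open>p\<^sub>0 < p\<^sub>1 < \<dots>\<close> be the primes from 23 on and \<open>Q\<^sub>k = \<Prod>j<k. p\<^sub>j ^ \<gamma>\<close>. Starting from the trivial measure,
  one builds probability densities on the integers modulo \<open>Q\<^sub>k\<close>; when \<open>p\<^sub>k\<close> enters, the measure of the
  residue classes whose modulus divides \<open>Q\<^sub>k\<^sub>+\<^sub>1\<close> but not \<open>Q\<^sub>k\<close> is reduced within each fibre over the integers modulo
  \<open>Q\<^sub>k\<close>, as far as is possible without multiplying any density by more than \<open>1 / (1 - \<delta>)\<close>. What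
  is left of them is controlled by the second moment of the proportion of the fibre that they
  cover, and the second moments grow at most like \<open>\<Prod>j<k. 1 + (3 / p\<^sub>j + \<dots>) / (1 - \<delta>)\<close>. Primes greater than 5
  have density at most \<open>8 / 30\<close>, so for \<open>\<delta> = 1 / 10\<close> this growth is sublinear in \<open>k\<close>, which
  makes the total covered measure a convergent sum; it is less than 1.
\<close>

section \<open>Means over residues and over fibres\<close>

definition mean :: "nat \<Rightarrow> (int \<Rightarrow> real) \<Rightarrow> real" where
  "mean Q g = (\<Sum>y<Q. g (int y)) / real Q"

text \<open>For \<open>g\<close> of period \<open>Q * R\<close> this is the conditional expectation
  of \<open>g\<close> given the residue of \<open>x\<close> modulo \<open>Q\<close>.\<close>

definition fibre_mean :: "nat \<Rightarrow> nat \<Rightarrow> (int \<Rightarrow> real) \<Rightarrow> int \<Rightarrow> real" where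
  "fibre_mean Q R g x = mean R (\<lambda>y. g (x + int Q * y))"

text \<open>Functions on the integers modulo \<open>Q\<close> are kept as periodic functions on
  \<open>int\<close>, so that passing to a multiple of \<open>Q\<close> does not change their
  type.\<close>

definition periodic :: "nat \<Rightarrow> (int \<Rightarrow> 'a) \<Rightarrow> bool" where
  "periodic Q g \<longleftrightarrow> (\<forall>x k. g (x + int Q * k) = g x)"

lemma periodicD: "periodic Q g \<Longrightarrow> g (x + int Q * k) = g x"
  by (simp add: periodic_def)

lemma periodic_mult:
  fixes f g :: "int \<Rightarrow> real"
  shows "periodic Q f \<Longrightarrow> periodic Q g \<Longrightarrow> periodic Q (\<lambda>x. f x * g x)"
  by (simp add: periodic_def)

lemma periodic_times_right: "periodic Q g \<Longrightarrow> periodic (Q * R) g"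
  by (auto simp: periodic_def mult.assoc)

lemma mean_mono: "(\<And>y. y < Q \<Longrightarrow> f (int y) \<le> g (int y)) \<Longrightarrow> mean Q f \<le> mean Q g"
  unfolding mean_def by (intro divide_right_mono sum_mono) auto

lemma mean_cong: "(\<And>y. y < Q \<Longrightarrow> f (int y) = g (int y)) \<Longrightarrow> mean Q f = mean Q g"
  unfolding mean_def by (intro arg_cong2[where f = "(/)"] sum.cong) auto

lemma mean_nonneg: "(\<And>x. 0 \<le> f x) \<Longrightarrow> 0 \<le> mean Q f"
  unfolding mean_def by (simp add: sum_nonneg)

lemma mean_cmult: "mean Q (\<lambda>x. c * g x) = c * mean Q g"
  by (simp add: mean_def sum_distrib_left)

lemma mean_add: "mean Q (\<lambda>x. f x + g x) = mean Q f + mean Q g"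
  by (simp add: mean_def sum.distrib add_divide_distrib)

lemma mean_sum: "mean Q (\<lambda>x. \<Sum>i\<in>I. g i x) = (\<Sum>i\<in>I. mean Q (g i))"
  unfolding mean_def by (subst sum.swap) (simp add: sum_divide_distrib)

lemma mean_const: "0 < Q \<Longrightarrow> mean Q (\<lambda>x. c) = c"
  by (simp add: mean_def)

text \<open>Each number below \<open>Q * R\<close> is \<open>x + Q * m\<close> for unique
  \<open>x < Q\<close> and \<open>m < R\<close>: the tower property of conditional
  expectations.\<close>

lemma mean_mult_fibre: "mean (Q * R) g = mean Q (fibre_mean Q R g)"
proof -
  have "(\<Sum>n<Q * R. g (int n)) = (\<Sum>m<R. sum (\<lambda>n. g (int n)) {m * Q..<m * Q + Q})"
    by (simp add: sum.nat_group mult.commute)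
  also have "\<dots> = (\<Sum>m<R. \<Sum>x<Q. g (int x + int Q * int m))"
  proof (rule sum.cong[OF refl])
    fix m
    have "sum (\<lambda>n. g (int n)) {0 + m * Q..<Q + m * Q} = (\<Sum>x=0..<Q. g (int (x + m * Q)))"
      by (rule sum.shift_bounds_nat_ivl)
    then show "sum (\<lambda>n. g (int n)) {m * Q..<m * Q + Q} = (\<Sum>x<Q. g (int x + int Q * int m))"
      by (simp add: add.commute mult.commute atLeast0LessThan)
  qed
  also have "\<dots> = (\<Sum>x<Q. \<Sum>m<R. g (int x + int Q * int m))"
    by (rule sum.swap)
  finally show ?thesis
    by (simp add: mean_def fibre_mean_def sum_divide_distrib mult.commute)
qed

lemma fibre_mean_mult_periodic:
  "periodic Q f \<Longrightarrow> fibre_mean Q R (\<lambda>x. f x * g x) x = f x * fibre_mean Q R g x"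
  by (simp add: fibre_mean_def periodicD mean_cmult)

section \<open>The distortion step\<close>

text \<open>
  With \<open>\<alpha>\<close> the proportion of \<open>B\<close> in a fibre, the new density is \<open>f (1 - \<theta> 1\<^sub>B) / (1 - \<theta> \<alpha>)\<close>, where
  \<open>\<theta> = min 1 (\<delta> / \<alpha>)\<close> is the largest choice for which the denominator is at least \<open>1 - \<delta>\<close>.
\<close>
lemma distortion_step:
  fixes f :: "int \<Rightarrow> real" and B :: "int set" and \<delta> :: real
  assumes "0 < R" and \<delta>: "0 < \<delta>" "\<delta> < 1"
    and f_nonneg: "\<And>x. 0 \<le> f x" and f_per: "periodic Q f"
    and B_per: "periodic (Q * R) (\<lambda>x. x \<in> B)"
  obtains f' where "\<And>x. 0 \<le> f' x" "periodic (Q * R) f'"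
    and "\<And>g. periodic Q g \<Longrightarrow> mean (Q * R) (\<lambda>x. f' x * g x) = mean Q (\<lambda>x. f x * g x)"
    and "\<And>g. (\<And>x. 0 \<le> g x) \<Longrightarrow>
      mean (Q * R) (\<lambda>x. f' x * g x) \<le> mean Q (\<lambda>x. f x * fibre_mean Q R g x) / (1 - \<delta>)"
    and "mean (Q * R) (\<lambda>x. f' x * indicator B x)
      \<le> mean Q (\<lambda>x. f x * (fibre_mean Q R (indicator B) x)\<^sup>2) / (4 * \<delta> * (1 - \<delta>))"
proof
  \<comment> \<open>Reducing the argument makes \<open>\<alpha>\<close> periodic by definition; for
    \<open>x < Q\<close>, all that \<open>mean Q\<close> sees, it is the fibre mean itself.\<close>
  define \<alpha> where "\<alpha> x = fibre_mean Q R (indicator B) (x mod int Q)" for x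
  define \<theta> where "\<theta> x = (if \<alpha> x \<le> \<delta> then 1 else \<delta> / \<alpha> x)" for x
  define \<rho> where "\<rho> x = (1 - \<theta> x * indicator B x) / (1 - \<theta> x * \<alpha> x)" for x
  define f' where "f' x = f x * \<rho> x" for x
  have \<alpha>_per: "periodic Q \<alpha>"
    by (simp add: periodic_def \<alpha>_def)
  then have \<theta>_per: "periodic Q \<theta>"
    by (simp add: periodic_def \<theta>_def)
  have \<alpha>0: "0 \<le> \<alpha> x" for x
    unfolding \<alpha>_def fibre_mean_def by (rule mean_nonneg) (simp split: split_indicator)
  have \<theta>: "0 \<le> \<theta> x" "\<theta> x \<le> 1" "\<theta> x * \<alpha> x \<le> \<delta>" for x
    using \<delta> by (auto simp: \<theta>_def)
  have \<theta>\<alpha>: "0 < 1 - \<theta> x * \<alpha> x" for x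
    using \<theta>(3)[of x] \<delta> by linarith
  have num: "0 \<le> 1 - \<theta> x * indicator B x" "1 - \<theta> x * indicator B x \<le> 1" for x
    using \<theta>[of x] by (auto simp: indicator_def)
  have \<rho>0: "0 \<le> \<rho> x" for x
    unfolding \<rho>_def using num \<theta>\<alpha>[of x] by (simp add: less_imp_le)
  have \<rho>1: "\<rho> x \<le> 1 / (1 - \<delta>)" for x
    unfolding \<rho>_def using num[of x] \<theta>(3)[of x] \<delta> by (intro frac_le) auto
  have f\<rho>: "mean (Q * R) (\<lambda>x. f' x * g x) = mean Q (\<lambda>x. f x * fibre_mean Q R (\<lambda>x. \<rho> x * g x) x)" for g
    unfolding mean_mult_fibre f'_def mult.assoc fibre_mean_mult_periodic[OF f_per] ..
  have ind: "fibre_mean Q R (indicator B) (int x) = \<alpha> (int x)" if "x < Q" for x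
    using that by (simp add: \<alpha>_def)
  \<comment> \<open>The denominator of \<open>\<rho>\<close> is the fibre mean of its numerator, so
    the mass above each residue modulo \<open>Q\<close> is preserved.\<close>
  have \<rho>_fibre: "fibre_mean Q R \<rho> (int x) = 1" if "x < Q" for x
  proof -
    have "fibre_mean Q R \<rho> (int x)
        = mean R (\<lambda>y. (1 / (1 - \<theta> (int x) * \<alpha> (int x))) * (1 + (- \<theta> (int x)) * indicator B (int x + int Q * y)))"
      unfolding fibre_mean_def \<rho>_def by (simp add: periodicD[OF \<theta>_per] periodicD[OF \<alpha>_per])
    also have "\<dots> = (1 / (1 - \<theta> (int x) * \<alpha> (int x))) * (1 + (- \<theta> (int x)) * \<alpha> (int x))"
      using ind[OF that] \<open>0 < R\<close>
      by (subst mean_cmult, subst mean_add, subst mean_cmult) (simp add: mean_const fibre_mean_def)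
    also have "\<dots> = 1"
      using \<theta>\<alpha>[of "int x"] by simp
    finally show ?thesis .
  qed
  show "0 \<le> f' x" for x
    by (simp add: f'_def f_nonneg \<rho>0)
  have "indicator B (x + int (Q * R) * k) = (indicator B x :: real)" for x k
    using periodicD[OF B_per, of x k] by (simp add: indicator_def)
  then show "periodic (Q * R) f'"
    using f_per[THEN periodic_times_right, of R] \<theta>_per[THEN periodic_times_right, of R]
      \<alpha>_per[THEN periodic_times_right, of R]
    unfolding f'_def periodic_def \<rho>_def by metis
  show "mean (Q * R) (\<lambda>x. f' x * g x) = mean Q (\<lambda>x. f x * g x)" if "periodic Q g" for g
  proof -
    have "fibre_mean Q R (\<lambda>x. \<rho> x * g x) (int x) = g (int x)" if "x < Q" for x
      using fibre_mean_mult_periodic[OF \<open>periodic Q g\<close>, of R \<rho> "int x"] \<rho>_fibre[OF that]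
      by (simp add: mult.commute)
    then show ?thesis
      unfolding f\<rho> by (intro mean_cong) simp
  qed
  show "mean (Q * R) (\<lambda>x. f' x * g x) \<le> mean Q (\<lambda>x. f x * fibre_mean Q R g x) / (1 - \<delta>)"
    if g: "\<And>x. 0 \<le> g x" for g
  proof -
    have "fibre_mean Q R (\<lambda>x. \<rho> x * g x) x \<le> fibre_mean Q R (\<lambda>x. (1 / (1 - \<delta>)) * g x) x" for x
      unfolding fibre_mean_def by (intro mean_mono mult_right_mono \<rho>1 g)
    then have "mean (Q * R) (\<lambda>x. f' x * g x) \<le> mean Q (\<lambda>x. f x * ((1 / (1 - \<delta>)) * fibre_mean Q R g x))"
      unfolding f\<rho> by (intro mean_mono mult_left_mono f_nonneg) (simp only: fibre_mean_def mean_cmult)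
    also have "\<dots> = mean Q (\<lambda>x. (1 / (1 - \<delta>)) * (f x * fibre_mean Q R g x))"
      by (simp add: mult_ac)
    finally show ?thesis
      by (subst (asm) mean_cmult) simp
  qed
  \<comment> \<open>Along a fibre \<open>\<rho>\<close> is constant on \<open>B\<close>; the share
    left there is 0 if \<open>\<alpha> \<le> \<delta>\<close> and
    \<open>(\<alpha> - \<delta>) / (1 - \<delta>)\<close> otherwise.\<close>
  have "fibre_mean Q R (\<lambda>x. \<rho> x * indicator B x) (int x)
      \<le> (1 / (4 * \<delta> * (1 - \<delta>))) * (\<alpha> (int x))\<^sup>2" if "x < Q" for x
  proof -
    let ?x = "int x"
    have "fibre_mean Q R (\<lambda>x. \<rho> x * indicator B x) ?x
        = mean R (\<lambda>y. ((1 - \<theta> ?x) / (1 - \<theta> ?x * \<alpha> ?x)) * indicator B (?x + int Q * y))"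
      unfolding fibre_mean_def \<rho>_def
      by (rule mean_cong) (simp add: periodicD[OF \<theta>_per] periodicD[OF \<alpha>_per] indicator_def)
    also have "\<dots> = ((1 - \<theta> ?x) / (1 - \<theta> ?x * \<alpha> ?x)) * \<alpha> ?x"
      using ind[OF that] by (subst mean_cmult) (simp add: fibre_mean_def)
    also have "\<dots> \<le> (1 / (4 * \<delta> * (1 - \<delta>))) * (\<alpha> ?x)\<^sup>2"
    proof (cases "\<alpha> ?x \<le> \<delta>")
      case True
      then show ?thesis using \<delta> by (simp add: \<theta>_def)
    next
      case False
      then have "0 < \<alpha> ?x" using \<delta> by linarith
      \<comment> \<open>This is \<open>(\<alpha> - 2 * \<delta>)^2 \<ge> 0\<close>, the source of
        the constant \<open>4 * \<delta> * (1 - \<delta>)\<close>.\<close>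
      have "4 * \<delta> * (\<alpha> ?x - \<delta>) \<le> (\<alpha> ?x)\<^sup>2"
        using zero_le_power2[of "\<alpha> ?x - 2 * \<delta>"] by (simp add: power2_eq_square algebra_simps)
      then have "\<alpha> ?x - \<delta> \<le> (\<alpha> ?x)\<^sup>2 / (4 * \<delta>)"
        using \<delta> by (simp add: field_simps)
      then have "(\<alpha> ?x - \<delta>) / (1 - \<delta>) \<le> (\<alpha> ?x)\<^sup>2 / (4 * \<delta>) / (1 - \<delta>)"
        using \<delta> by (intro divide_right_mono) auto
      then have "(\<alpha> ?x - \<delta>) / (1 - \<delta>) \<le> (1 / (4 * \<delta> * (1 - \<delta>))) * (\<alpha> ?x)\<^sup>2"
        by simp
      moreover have "((1 - \<theta> ?x) / (1 - \<theta> ?x * \<alpha> ?x)) * \<alpha> ?x = (\<alpha> ?x - \<delta>) / (1 - \<delta>)"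
      proof -
        have "(1 - \<delta> / \<alpha> ?x) * \<alpha> ?x = \<alpha> ?x - \<delta>"
          using \<open>0 < \<alpha> ?x\<close> by (simp add: field_simps)
        then show ?thesis
          using False \<open>0 < \<alpha> ?x\<close> by (simp add: \<theta>_def)
      qed
      ultimately show ?thesis by simp
    qed
    finally show ?thesis .
  qed
  then have "mean (Q * R) (\<lambda>x. f' x * indicator B x)
      \<le> mean Q (\<lambda>x. f x * ((1 / (4 * \<delta> * (1 - \<delta>))) * (fibre_mean Q R (indicator B) x)\<^sup>2))"
    unfolding f\<rho> by (intro mean_mono mult_left_mono f_nonneg) (simp add: ind)
  also have "\<dots> = mean Q (\<lambda>x. (1 / (4 * \<delta> * (1 - \<delta>))) * (f x * (fibre_mean Q R (indicator B) x)\<^sup>2))"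
    by (simp add: mult_ac)
  finally show "mean (Q * R) (\<lambda>x. f' x * indicator B x)
      \<le> mean Q (\<lambda>x. f x * (fibre_mean Q R (indicator B) x)\<^sup>2) / (4 * \<delta> * (1 - \<delta>))"
    by (subst (asm) mean_cmult) simp
qed

section \<open>Residue classes modulo prime powers within a fibre\<close>

text \<open>All elements of \<open>A\<close> share one remainder modulo \<open>M\<close>, so the
  quotient by \<open>M\<close>, which is below \<open>K\<close>, determines them.\<close>

lemma card_congruent_below:
  fixes M K :: nat
  assumes "0 < M" and A: "\<And>y z. y \<in> A \<Longrightarrow> z \<in> A \<Longrightarrow> [y = z] (mod M)" and "A \<subseteq> {..<M * K}"
  shows "card A \<le> K"
proof -
  have "inj_on (\<lambda>y. y div M) A"
  proof (rule inj_onI)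
    fix y z assume "y \<in> A" "z \<in> A" "y div M = z div M"
    with A[of y z] show "y = z"
      by (metis cong_def div_mult_mod_eq)
  qed
  moreover have "(\<lambda>y. y div M) ` A \<subseteq> {..<K}"
    using assms(3) by (auto simp: less_mult_imp_div_less mult.commute)
  ultimately show ?thesis
    by (metis card_inj_on_le card_lessThan finite_lessThan)
qed

text \<open>Since \<open>Q\<close> is invertible modulo \<open>p ^ e\<close>, the congruence
  confines the fibre coordinate \<open>y\<close> to one class modulo \<open>p ^ e\<close>.\<close>

lemma fibre_mean_residue_class_le:
  assumes "0 < p" "coprime Q p" "e \<le> \<gamma>"
  shows "fibre_mean Q (p ^ \<gamma>) (\<lambda>z. of_bool [z = c] (mod int (p ^ e))) x \<le> 1 / real (p ^ e)"
proof -
  let ?A = "{y. y < p ^ \<gamma> \<and> [x + int Q * int y = c] (mod int (p ^ e))}"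
  have "card ?A \<le> p ^ (\<gamma> - e)"
  proof (rule card_congruent_below)
    show "0 < p ^ e" using assms by simp
    show "?A \<subseteq> {..<p ^ e * p ^ (\<gamma> - e)}"
      using assms by (auto simp flip: power_add)
    fix y z assume "y \<in> ?A" "z \<in> ?A"
    then have "[x + int Q * int y = x + int Q * int z] (mod int (p ^ e))"
      by (auto intro: cong_trans cong_sym)
    then have "[int (Q * y) = int (Q * z)] (mod int (p ^ e))"
      by (simp add: cong_add_lcancel)
    then have "[Q * y = Q * z] (mod p ^ e)"
      by (simp only: cong_int_iff)
    then show "[y = z] (mod p ^ e)"
      using assms by (subst (asm) cong_mult_lcancel_nat) (auto simp: coprime_commute)
  qed
  moreover have "(\<Sum>y<p ^ \<gamma>. of_bool [x + int Q * int y = c] (mod int (p ^ e))) = real (card ?A)"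
  proof -
    have "?A = {..<p ^ \<gamma>} \<inter> {y. [x + int Q * int y = c] (mod int (p ^ e))}" by auto
    then show ?thesis by simp
  qed
  ultimately have "fibre_mean Q (p ^ \<gamma>) (\<lambda>z. of_bool [z = c] (mod int (p ^ e))) x
      \<le> real (p ^ (\<gamma> - e)) / real (p ^ \<gamma>)"
    unfolding fibre_mean_def mean_def by (intro divide_right_mono) auto
  also have "real (p ^ (\<gamma> - e)) / real (p ^ \<gamma>) = 1 / real (p ^ e)"
    using assms by (simp add: field_simps flip: power_add of_nat_mult of_nat_power)
  finally show ?thesis .
qed

section \<open>Hit counts and their fibre means\<close>

text \<open>All divisors of \<open>Q\<close> are counted, whether or not they belong to the system,
  so bounds on the moments of \<open>hits\<close> do not depend on the set of moduli.\<close>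

definition hits :: "nat \<Rightarrow> (nat \<Rightarrow> int) \<Rightarrow> int \<Rightarrow> real" where
  "hits Q a x = (\<Sum>d | d dvd Q. of_bool [x = a d] (mod int d))"

text \<open>
  The part of \<open>hits (Q * p ^ \<gamma>)\<close> coming from the divisors whose \<open>p\<close>-part is \<open>p ^ e\<close>.
\<close>
definition slice :: "nat \<Rightarrow> nat \<Rightarrow> nat \<Rightarrow> (nat \<Rightarrow> int) \<Rightarrow> int \<Rightarrow> real" where
  "slice Q p e a x = (\<Sum>d | d dvd Q. of_bool [x = a (d * p ^ e)] (mod int (d * p ^ e)))"

lemma hits_nonneg: "0 \<le> hits Q a x"
  by (simp add: hits_def sum_nonneg)

lemma slice_nonneg: "0 \<le> slice Q p e a x"
  by (simp add: slice_def sum_nonneg)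

lemma slice_0: "slice Q p 0 a = hits Q a"
  by (simp add: slice_def hits_def fun_eq_iff)

lemma cong_add_multiple_iff:
  assumes "d dvd Q"
  shows "[x + int Q * y = c] (mod int d) \<longleftrightarrow> [x = c] (mod int d)"
proof -
  have "[x + int Q * y = x] (mod int d)"
    using assms by (simp add: cong_iff_dvd_diff)
  then show ?thesis
    using cong_sym cong_trans by blast
qed

lemma periodic_hits: "periodic Q (hits Q a)"
  unfolding periodic_def hits_def by (intro allI sum.cong refl) (simp add: cong_add_multiple_iff)

lemma dvd_mult_prime_powerE:
  fixes Q p m :: nat
  assumes "m dvd Q * p ^ \<gamma>" "prime p"
  obtains d e where "d dvd Q" "e \<le> \<gamma>" "m = d * p ^ e"
proof -
  obtain d r where "m = d * r" "d dvd Q" "r dvd p ^ \<gamma>"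
    using assms(1) division_decomp by blast
  with assms(2) that show thesis
    by (metis divides_primepow_nat)
qed

text \<open>Every divisor of \<open>Q * p ^ \<gamma>\<close> has the form \<open>d * p ^ e\<close>.
  It may have several such forms if \<open>p\<close> divides \<open>Q\<close>, hence the
  inequality.\<close>

lemma hits_mult_le:
  assumes "prime p" "0 < Q"
  shows "hits (Q * p ^ \<gamma>) a x \<le> (\<Sum>e\<le>\<gamma>. slice Q p e a x)"
proof -
  let ?g = "\<lambda>m. of_bool [x = a m] (mod int m) :: real"
  let ?I = "{..\<gamma>} \<times> {d. d dvd Q}" and ?f = "\<lambda>(e, d). d * p ^ e"
  have fin: "finite ?I" using assms by simp
  have "hits (Q * p ^ \<gamma>) a x \<le> sum ?g (?f ` ?I)"
    unfolding hits_def
  proof (rule sum_mono2)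
    show "{d. d dvd Q * p ^ \<gamma>} \<subseteq> ?f ` ?I"
      by (force elim: dvd_mult_prime_powerE[OF _ assms(1)])
  qed (use fin in auto)
  also have "\<dots> \<le> sum (?g \<circ> ?f) ?I"
    by (rule sum_image_le) (use fin in auto)
  also have "\<dots> = (\<Sum>e\<le>\<gamma>. slice Q p e a x)"
    unfolding slice_def using assms by (subst sum.Sigma) (auto simp: case_prod_unfold intro!: sum.cong)
  finally show ?thesis .
qed

lemma fibre_mean_mono: "(\<And>z. f z \<le> g z) \<Longrightarrow> fibre_mean Q R f x \<le> fibre_mean Q R g x"
  unfolding fibre_mean_def by (intro mean_mono)

lemma fibre_mean_sum: "fibre_mean Q R (\<lambda>x. \<Sum>i\<in>I. g i x) x = (\<Sum>i\<in>I. fibre_mean Q R (g i) x)"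
  unfolding fibre_mean_def by (rule mean_sum)

text \<open>The periodic condition \<open>P\<close> is constant along the fibre and factors out; the
  congruence modulo \<open>p ^ e\<close> leaves a proportion of at most
  \<open>1 / p ^ e\<close>.\<close>

lemma fibre_mean_cong_periodic:
  assumes "0 < p" "coprime Q p" "e \<le> \<gamma>" and P: "periodic Q P"
    and le: "\<And>z. f z \<le> of_bool (P z) * of_bool [z = c] (mod int (p ^ e))"
  shows "fibre_mean Q (p ^ \<gamma>) f x \<le> of_bool (P x) / real (p ^ e)"
proof -
  have "fibre_mean Q (p ^ \<gamma>) f x
      \<le> fibre_mean Q (p ^ \<gamma>) (\<lambda>z. of_bool (P z) * of_bool [z = c] (mod int (p ^ e))) x"
    by (rule fibre_mean_mono) (rule le)
  also have "\<dots> = of_bool (P x) * fibre_mean Q (p ^ \<gamma>) (\<lambda>z. of_bool [z = c] (mod int (p ^ e))) x"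
    using P by (intro fibre_mean_mult_periodic) (simp add: periodic_def)
  also have "\<dots> \<le> of_bool (P x) * (1 / real (p ^ e))"
    by (intro mult_left_mono fibre_mean_residue_class_le assms) simp
  finally show ?thesis by simp
qed

lemma cong_mult_modulusD:
  fixes x :: int
  shows "[x = c] (mod d * q) \<Longrightarrow> [x = c] (mod d) \<and> [x = c] (mod q)"
  by (meson cong_dvd_modulus dvd_triv_left dvd_triv_right)

text \<open>A congruence modulo \<open>d * p ^ e\<close> implies one modulo \<open>d\<close>, fixed
  along the fibre, and one modulo \<open>p ^ e\<close>. Over all \<open>d\<close>, the former add up
  to \<open>hits\<close> for the residues \<open>a (d * p ^ e)\<close>.\<close>

lemma fibre_mean_slice_le:
  assumes "0 < p" "coprime Q p" "e \<le> \<gamma>"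
  shows "fibre_mean Q (p ^ \<gamma>) (slice Q p e a) x \<le> hits Q (\<lambda>d. a (d * p ^ e)) x / real (p ^ e)"
proof -
  have "fibre_mean Q (p ^ \<gamma>) (slice Q p e a) x = (\<Sum>d | d dvd Q.
      fibre_mean Q (p ^ \<gamma>) (\<lambda>x. of_bool [x = a (d * p ^ e)] (mod int (d * p ^ e))) x)"
    unfolding slice_def by (rule fibre_mean_sum)
  also have "\<dots> \<le> (\<Sum>d | d dvd Q. of_bool [x = a (d * p ^ e)] (mod int d) / real (p ^ e))"
  proof (rule sum_mono)
    fix d assume "d \<in> {d. d dvd Q}"
    then show "fibre_mean Q (p ^ \<gamma>) (\<lambda>x. of_bool [x = a (d * p ^ e)] (mod int (d * p ^ e))) x
        \<le> of_bool [x = a (d * p ^ e)] (mod int d) / real (p ^ e)"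
      by (intro fibre_mean_cong_periodic[OF assms, where c = "a (d * p ^ e)"])
        (auto simp: periodic_def cong_add_multiple_iff dest: cong_mult_modulusD)
  qed
  finally show ?thesis
    by (simp add: hits_def sum_divide_distrib)
qed

lemma fibre_mean_slice_mult_le:
  assumes "0 < p" "coprime Q p" "e \<le> \<gamma>" "e' \<le> \<gamma>"
  shows "fibre_mean Q (p ^ \<gamma>) (\<lambda>z. slice Q p e a z * slice Q p e' b z) x
    \<le> hits Q (\<lambda>d. a (d * p ^ e)) x * hits Q (\<lambda>d. b (d * p ^ e')) x / real (p ^ max e e')"
proof -
  let ?A = "\<lambda>d z. of_bool [z = a (d * p ^ e)] (mod int (d * p ^ e)) :: real"
  let ?B = "\<lambda>d z. of_bool [z = b (d * p ^ e')] (mod int (d * p ^ e')) :: real"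
  let ?P = "\<lambda>d d' z. [z = a (d * p ^ e)] (mod int d) \<and> [z = b (d' * p ^ e')] (mod int d')"
  have "fibre_mean Q (p ^ \<gamma>) (\<lambda>z. slice Q p e a z * slice Q p e' b z) x
      = (\<Sum>d | d dvd Q. \<Sum>d' | d' dvd Q. fibre_mean Q (p ^ \<gamma>) (\<lambda>z. ?A d z * ?B d' z) x)"
    unfolding slice_def sum_product fibre_mean_sum ..
  also have "\<dots> \<le> (\<Sum>d | d dvd Q. \<Sum>d' | d' dvd Q. of_bool (?P d d' x) / real (p ^ max e e'))"
  proof (intro sum_mono)
    fix d d' assume "d \<in> {d. d dvd Q}" "d' \<in> {d'. d' dvd Q}"
    then have per: "periodic Q (?P d d')"
      by (simp add: periodic_def cong_add_multiple_iff)
    \<comment> \<open>Of the two congruences modulo powers of \<open>p\<close> only the one with the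
      larger exponent is kept.\<close>
    define c where "c = (if e \<le> e' then b (d' * p ^ e') else a (d * p ^ e))"
    show "fibre_mean Q (p ^ \<gamma>) (\<lambda>z. ?A d z * ?B d' z) x \<le> of_bool (?P d d' x) / real (p ^ max e e')"
      by (rule fibre_mean_cong_periodic[where c = c])
        (use assms per in \<open>auto simp: c_def max_def dest: cong_mult_modulusD\<close>)
  qed
  also have "\<dots> = hits Q (\<lambda>d. a (d * p ^ e)) x * hits Q (\<lambda>d. b (d * p ^ e')) x / real (p ^ max e e')"
    unfolding hits_def sum_product by (simp add: sum_divide_distrib of_bool_conj)
  finally show ?thesis .
qed

section \<open>Sums over prime powers\<close>

text \<open>Splits the remainder \<open>X / s ^ n\<close> of a series into the next term and the
  next remainder, which is the induction step of both sums below.\<close>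

lemma divide_power_split:
  fixes s X Y Z :: real
  assumes "s * X = Y + Z" "s \<noteq> 0"
  shows "X / s ^ n = Y / s ^ Suc n + Z / s ^ Suc n"
proof -
  have "X / s ^ n = (s * X) / s ^ Suc n"
    using assms(2) by simp
  then show ?thesis
    by (simp only: assms(1) add_divide_distrib)
qed

text \<open>The maximum of \<open>e\<close> and \<open>e'\<close> is \<open>k\<close> for
  \<open>2 * k + 1\<close> pairs, and the full series of \<open>(2 * k + 1) / p ^ k\<close> has the
  value on the right.\<close>

lemma sum_power_max_le:
  fixes p :: nat
  assumes "2 \<le> p"
  shows "(\<Sum>e\<le>\<gamma>. \<Sum>e'\<le>\<gamma>. 1 / real (p ^ max e e')) \<le> 1 + (3 * real p - 1) / (real p - 1)\<^sup>2"
proof -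
  define t where "t = real p - 1"
  have t: "1 \<le> t" "real p = t + 1" using assms by (auto simp: t_def)
  \<comment> \<open>An exact identity: the second summand is the tail of the series beyond
    \<open>\<gamma>\<close>.\<close>
  have "(\<Sum>e\<le>\<gamma>. \<Sum>e'\<le>\<gamma>. 1 / (t + 1) ^ max e e') + ((3 * t + 2) / t\<^sup>2 + 2 * real \<gamma> / t) / (t + 1) ^ \<gamma>
      = 1 + (3 * t + 2) / t\<^sup>2"
  proof (induction \<gamma>)
    case (Suc \<gamma>)
    have "(\<Sum>e\<le>\<gamma>. 1 / (t + 1) ^ max e (Suc \<gamma>)) = (\<Sum>e\<le>\<gamma>. 1 / (t + 1) ^ Suc \<gamma>)"
      by (intro sum.cong) (auto simp: max_def)
    moreover have "(\<Sum>e\<le>\<gamma>. 1 / (t + 1) ^ max (Suc \<gamma>) e) = (\<Sum>e\<le>\<gamma>. 1 / (t + 1) ^ Suc \<gamma>)"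
      by (intro sum.cong) (auto simp: max_def)
    ultimately have "(\<Sum>e\<le>Suc \<gamma>. \<Sum>e'\<le>Suc \<gamma>. 1 / (t + 1) ^ max e e')
        = (\<Sum>e\<le>\<gamma>. \<Sum>e'\<le>\<gamma>. 1 / (t + 1) ^ max e e') + (2 * real \<gamma> + 3) / (t + 1) ^ Suc \<gamma>"
      by (simp add: sum.distrib add_divide_distrib field_simps)
    moreover have "((3 * t + 2) / t\<^sup>2 + 2 * real \<gamma> / t) / (t + 1) ^ \<gamma>
        = (2 * real \<gamma> + 3) / (t + 1) ^ Suc \<gamma> + ((3 * t + 2) / t\<^sup>2 + 2 * real (Suc \<gamma>) / t) / (t + 1) ^ Suc \<gamma>"
    proof -
      have "(t + 1) * ((3 * t + 2) / t\<^sup>2 + 2 * real \<gamma> / t)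
          = 2 * real \<gamma> + 3 + ((3 * t + 2) / t\<^sup>2 + 2 * real (Suc \<gamma>) / t)"
        using t(1) by (simp add: field_simps power2_eq_square)
      then show ?thesis
        using t(1) by (intro divide_power_split) auto
    qed
    ultimately show ?case using Suc.IH by linarith
  qed simp
  moreover have "0 \<le> ((3 * t + 2) / t\<^sup>2 + 2 * real \<gamma> / t) / (t + 1) ^ \<gamma>"
    using t by simp
  ultimately have "(\<Sum>e\<le>\<gamma>. \<Sum>e'\<le>\<gamma>. 1 / (t + 1) ^ max e e') \<le> 1 + (3 * t + 2) / t\<^sup>2"
    by linarith
  then show ?thesis
    using t by (simp add: algebra_simps)
qed

lemma sum_power_le:
  fixes p :: nat
  assumes "2 \<le> p"
  shows "(\<Sum>e=1..\<gamma>. 1 / real (p ^ e)) \<le> 1 / (real p - 1)"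
proof -
  define t where "t = real p - 1"
  have t: "1 \<le> t" "real p = t + 1" using assms by (auto simp: t_def)
  have "(\<Sum>e=1..\<gamma>. 1 / (t + 1) ^ e) + (1 / t) / (t + 1) ^ \<gamma> = 1 / t"
  proof (induction \<gamma>)
    case (Suc \<gamma>)
    have "(1 / t) / (t + 1) ^ \<gamma> = 1 / (t + 1) ^ Suc \<gamma> + (1 / t) / (t + 1) ^ Suc \<gamma>"
      using t(1) by (intro divide_power_split) (simp_all add: field_simps)
    then show ?case using Suc.IH by simp
  qed simp
  moreover have "0 \<le> (1 / t) / (t + 1) ^ \<gamma>"
    using t by simp
  ultimately have "(\<Sum>e=1..\<gamma>. 1 / (t + 1) ^ e) \<le> 1 / t" by linarith
  then show ?thesis
    using t by simp
qed

section \<open>The invariant and its propagation to one more prime\<close>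

definition covered :: "nat set \<Rightarrow> (nat \<Rightarrow> int) \<Rightarrow> nat \<Rightarrow> int set" where
  "covered S a Q = (\<Union>m\<in>{m \<in> S. m dvd Q}. residue_class (a m) m)"

text \<open>
  In the invariant of the construction, \<open>W\<close> has to bound the mixed moments for all choices of
  residues, since the slices over \<open>Q * p ^ \<gamma>\<close> come with a different choice for each exponent.
\<close>
definition tame :: "nat set \<Rightarrow> (nat \<Rightarrow> int) \<Rightarrow> nat \<Rightarrow> real \<Rightarrow> real \<Rightarrow> bool" where
  "tame S a Q W c \<longleftrightarrow> (\<exists>f. (\<forall>x. 0 \<le> f x) \<and> periodic Q f \<and> mean Q f = 1 \<and>
    (\<forall>b b'. mean Q (\<lambda>x. f x * (hits Q b x * hits Q b' x)) \<le> W) \<and>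
    mean Q (\<lambda>x. f x * indicator (covered S a Q) x) \<le> c)"

lemma in_covered_iff: "x \<in> covered S a Q \<longleftrightarrow> (\<exists>m\<in>S. m dvd Q \<and> [x = a m] (mod int m))"
  by (auto simp: covered_def residue_class_def)

lemma periodic_covered: "periodic Q (\<lambda>x. x \<in> covered S a Q)"
  unfolding periodic_def in_covered_iff using cong_add_multiple_iff by blast

lemma tame_1:
  assumes "1 \<notin> S"
  shows "tame S a 1 1 0"
proof -
  have "covered S a 1 = {}" using assms by (auto simp: covered_def)
  moreover have "hits 1 b x = 1" for b x by (simp add: hits_def)
  ultimately show ?thesis
    unfolding tame_def by (intro exI[of _ "\<lambda>x. 1"]) (simp add: periodic_def mean_def)
qed

text \<open>Mixed moments are split by the exponents of \<open>p\<close>: the pair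
  \<open>(0, 0)\<close> keeps its moment, any other pays \<open>1 / (1 - \<delta>)\<close> but gains
  \<open>1 / p ^ max e e'\<close>. The old covered set keeps its measure, and the new classes are
  bounded by second moments.\<close>

lemma tame_step:
  fixes \<delta> :: real
  assumes tame: "tame S a Q W c" and p: "prime p" "coprime Q p" "0 < Q" and \<delta>: "0 < \<delta>" "\<delta> < 1"
  shows "tame S a (Q * p ^ \<gamma>) (W * (1 + ((3 * real p - 1) / (real p - 1)\<^sup>2) / (1 - \<delta>)))
    (c + W / ((real p - 1)\<^sup>2 * (4 * \<delta> * (1 - \<delta>))))"
proof -
  let ?R = "p ^ \<gamma>" and ?s = "(3 * real p - 1) / (real p - 1)\<^sup>2"
  obtain f where f: "\<And>x. 0 \<le> f x" "periodic Q f" "mean Q f = 1"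
    and W: "\<And>b b'. mean Q (\<lambda>x. f x * (hits Q b x * hits Q b' x)) \<le> W"
    and c: "mean Q (\<lambda>x. f x * indicator (covered S a Q) x) \<le> c"
    using tame unfolding tame_def by blast
  have p2: "2 \<le> p" "0 < p" using p(1) by (auto simp: prime_ge_2_nat prime_gt_0_nat)
  have W0: "0 \<le> W"
    by (rule order_trans[OF mean_nonneg W]) (simp add: f hits_nonneg)
  define B where "B = (\<Union>m\<in>{m \<in> S. m dvd Q * ?R \<and> \<not> m dvd Q}. residue_class (a m) m)"
  have B_per: "periodic (Q * ?R) (\<lambda>x. x \<in> B)"
    unfolding periodic_def B_def residue_class_def
    using cong_add_multiple_iff[of _ "Q * ?R"] by (auto simp del: of_nat_mult)
  have "0 < ?R" using p2 by simp
  show ?thesis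
  proof (rule distortion_step[OF \<open>0 < ?R\<close> \<delta> f(1,2) B_per])
    fix f' assume f': "\<And>x. 0 \<le> f' x" "periodic (Q * ?R) f'"
      and eq: "\<And>g. periodic Q g \<Longrightarrow> mean (Q * ?R) (\<lambda>x. f' x * g x) = mean Q (\<lambda>x. f x * g x)"
      and le: "\<And>g. (\<And>x. 0 \<le> g x) \<Longrightarrow>
        mean (Q * ?R) (\<lambda>x. f' x * g x) \<le> mean Q (\<lambda>x. f x * fibre_mean Q ?R g x) / (1 - \<delta>)"
      and B: "mean (Q * ?R) (\<lambda>x. f' x * indicator B x)
        \<le> mean Q (\<lambda>x. f x * (fibre_mean Q ?R (indicator B) x)\<^sup>2) / (4 * \<delta> * (1 - \<delta>))"
    have "mean (Q * ?R) f' = 1"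
      using eq[of "\<lambda>x. 1"] f(3) by (simp add: periodic_def)
    moreover have "mean (Q * ?R) (\<lambda>x. f' x * (hits (Q * ?R) b x * hits (Q * ?R) b' x))
        \<le> W * (1 + ?s / (1 - \<delta>))" for b b'
    proof -
      let ?T = "\<lambda>e e'. mean (Q * ?R) (\<lambda>x. f' x * (slice Q p e b x * slice Q p e' b' x))"
      have T: "?T e e' \<le> W / (1 - \<delta>) * (1 / real (p ^ max e e'))" if "e \<le> \<gamma>" "e' \<le> \<gamma>" for e e'
      proof -
        let ?h = "\<lambda>x. hits Q (\<lambda>d. b (d * p ^ e)) x * hits Q (\<lambda>d. b' (d * p ^ e')) x"
        have "?T e e' \<le> mean Q (\<lambda>x. f x * fibre_mean Q ?R (\<lambda>x. slice Q p e b x * slice Q p e' b' x) x) / (1 - \<delta>)"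
          by (rule le) (simp add: slice_nonneg)
        also have "\<dots> \<le> mean Q (\<lambda>x. f x * (?h x / real (p ^ max e e'))) / (1 - \<delta>)"
          by (intro divide_right_mono mean_mono mult_left_mono f fibre_mean_slice_mult_le)
            (use p p2 that \<delta> in auto)
        also have "\<dots> = (1 / real (p ^ max e e')) * mean Q (\<lambda>x. f x * ?h x) / (1 - \<delta>)"
          by (subst mean_cmult[symmetric]) (simp add: mult_ac)
        also have "\<dots> \<le> (1 / real (p ^ max e e')) * W / (1 - \<delta>)"
          by (intro divide_right_mono mult_left_mono W) (use \<delta> in auto)
        finally show ?thesis by (simp add: mult_ac)
      qed
      have D: "(\<Sum>e\<le>\<gamma>. of_bool (e = 0) * v) = v" for v :: real
        by (simp add: of_bool_def if_distrib[of "\<lambda>u. u * v"] cong: if_cong)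
      \<comment> \<open>Slices with exponent 0 are functions modulo \<open>Q\<close>, whose means
        the distortion preserves, so no factor \<open>1 / (1 - \<delta>)\<close> is lost.\<close>
      have T0: "?T 0 0 \<le> W"
        unfolding slice_0 by (subst eq) (use W in \<open>auto intro: periodic_mult periodic_hits\<close>)
      have "mean (Q * ?R) (\<lambda>x. f' x * (hits (Q * ?R) b x * hits (Q * ?R) b' x))
          \<le> mean (Q * ?R) (\<lambda>x. f' x * ((\<Sum>e\<le>\<gamma>. slice Q p e b x) * (\<Sum>e'\<le>\<gamma>. slice Q p e' b' x)))"
        by (intro mean_mono mult_left_mono mult_mono hits_mult_le f' sum_nonneg slice_nonneg hits_nonneg p)
      also have "\<dots> = (\<Sum>e\<le>\<gamma>. \<Sum>e'\<le>\<gamma>. ?T e e')"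
        unfolding sum_product unfolding sum_distrib_left mean_sum ..
      \<comment> \<open>The subtracted product is nonzero at most at \<open>(0, 0)\<close>, where it
        lowers the general bound \<open>W / (1 - \<delta>)\<close> to \<open>W\<close>.\<close>
      also have "\<dots> \<le> (\<Sum>e\<le>\<gamma>. \<Sum>e'\<le>\<gamma>. W / (1 - \<delta>) * (1 / real (p ^ max e e'))
          - of_bool (e = 0) * (of_bool (e' = 0) * (W / (1 - \<delta>) - W)))"
      proof (intro sum_mono)
        fix e e' assume "e \<in> {..\<gamma>}" "e' \<in> {..\<gamma>}"
        then show "?T e e' \<le> W / (1 - \<delta>) * (1 / real (p ^ max e e'))
            - of_bool (e = 0) * (of_bool (e' = 0) * (W / (1 - \<delta>) - W))"
          using T[of e e'] T0 by (cases "e = 0 \<and> e' = 0") auto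
      qed
      also have "\<dots> = W / (1 - \<delta>) * (\<Sum>e\<le>\<gamma>. \<Sum>e'\<le>\<gamma>. 1 / real (p ^ max e e')) - (W / (1 - \<delta>) - W)"
        by (simp only: sum_subtractf sum_distrib_left[symmetric] D)
      also have "\<dots> \<le> W / (1 - \<delta>) * (1 + ?s) - (W / (1 - \<delta>) - W)"
        by (intro diff_right_mono mult_left_mono sum_power_max_le p2) (use W0 \<delta> in auto)
      also have "\<dots> = W * (1 + ?s / (1 - \<delta>))"
        by (simp add: distrib_left)
      finally show ?thesis .
    qed
    moreover have "mean (Q * ?R) (\<lambda>x. f' x * indicator (covered S a (Q * ?R)) x)
        \<le> c + W / ((real p - 1)\<^sup>2 * (4 * \<delta> * (1 - \<delta>)))"
    proof -
      let ?h = "\<lambda>e. hits Q (\<lambda>d. a (d * p ^ e))"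
      \<comment> \<open>A modulus entering through \<open>B\<close> does not divide
        \<open>Q\<close>, so its exponent of \<open>p\<close> is at least 1.\<close>
      have "indicator B x \<le> (\<Sum>e=1..\<gamma>. slice Q p e a x)" for x
      proof (cases "x \<in> B")
        case True
        then obtain m where m: "m dvd Q * ?R" "\<not> m dvd Q" "[x = a m] (mod int m)"
          by (auto simp: B_def residue_class_def)
        obtain d e where de: "d dvd Q" "e \<le> \<gamma>" "m = d * p ^ e"
          using dvd_mult_prime_powerE[OF m(1) p(1)] .
        have "e \<noteq> 0" using m(2) de by (auto intro: ccontr)
        have "1 \<le> slice Q p e a x"
          unfolding slice_def
          by (rule order_trans[OF _ member_le_sum[where i = d]]) (use m de p in auto)
        also have "\<dots> \<le> (\<Sum>e=1..\<gamma>. slice Q p e a x)"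
          using \<open>e \<noteq> 0\<close> de by (intro member_le_sum) (auto simp: slice_nonneg)
        finally show ?thesis using True by simp
      qed (simp add: sum_nonneg slice_nonneg)
      then have "fibre_mean Q ?R (indicator B) x \<le> fibre_mean Q ?R (\<lambda>x. \<Sum>e=1..\<gamma>. slice Q p e a x) x" for x
        by (rule fibre_mean_mono)
      also have "fibre_mean Q ?R (\<lambda>x. \<Sum>e=1..\<gamma>. slice Q p e a x) x \<le> (\<Sum>e=1..\<gamma>. ?h e x / real (p ^ e))" for x
        unfolding fibre_mean_sum by (intro sum_mono fibre_mean_slice_le) (use p p2 in auto)
      finally have "mean Q (\<lambda>x. f x * (fibre_mean Q ?R (indicator B) x)\<^sup>2)
          \<le> mean Q (\<lambda>x. f x * (\<Sum>e=1..\<gamma>. ?h e x / real (p ^ e))\<^sup>2)"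
        by (intro mean_mono mult_left_mono f power_mono)
          (auto simp: fibre_mean_def intro!: mean_nonneg)
      \<comment> \<open>The square expands into mixed moments for the residues
        \<open>a (d * p ^ e)\<close> and \<open>a (d * p ^ e')\<close>, each at most
        \<open>W\<close>.\<close>
      also have "\<dots> = mean Q (\<lambda>x. \<Sum>e=1..\<gamma>. \<Sum>e'=1..\<gamma>.
          (1 / real (p ^ e) * (1 / real (p ^ e'))) * (f x * (?h e x * ?h e' x)))"
        unfolding power2_eq_square unfolding sum_product by (simp add: sum_distrib_left mult_ac)
      also have "\<dots> = (\<Sum>e=1..\<gamma>. \<Sum>e'=1..\<gamma>.
          (1 / real (p ^ e) * (1 / real (p ^ e'))) * mean Q (\<lambda>x. f x * (?h e x * ?h e' x)))"
        by (simp only: mean_sum mean_cmult)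
      also have "\<dots> \<le> (\<Sum>e=1..\<gamma>. \<Sum>e'=1..\<gamma>. (1 / real (p ^ e) * (1 / real (p ^ e'))) * W)"
        by (intro sum_mono mult_left_mono W) auto
      also have "\<dots> = (\<Sum>e=1..\<gamma>. 1 / real (p ^ e))\<^sup>2 * W"
        unfolding power2_eq_square unfolding sum_product unfolding sum_distrib_right ..
      also have "\<dots> \<le> (1 / (real p - 1))\<^sup>2 * W"
        by (intro mult_right_mono power_mono sum_power_le p2 W0 sum_nonneg) auto
      finally have "mean Q (\<lambda>x. f x * (fibre_mean Q ?R (indicator B) x)\<^sup>2) / (4 * \<delta> * (1 - \<delta>))
          \<le> (1 / (real p - 1))\<^sup>2 * W / (4 * \<delta> * (1 - \<delta>))"
        using \<delta> by (intro divide_right_mono) auto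
      with B have B': "mean (Q * ?R) (\<lambda>x. f' x * indicator B x) \<le> W / ((real p - 1)\<^sup>2 * (4 * \<delta> * (1 - \<delta>)))"
        by (simp add: power_divide)
      have "periodic Q (indicator (covered S a Q) :: int \<Rightarrow> real)"
        using periodic_covered[of Q S a] by (simp add: periodic_def indicator_def)
      then have A: "mean (Q * ?R) (\<lambda>x. f' x * indicator (covered S a Q) x) \<le> c"
        using c by (simp add: eq)
      have "mean (Q * ?R) (\<lambda>x. f' x * indicator (covered S a (Q * ?R)) x)
          \<le> mean (Q * ?R) (\<lambda>x. f' x * indicator (covered S a Q) x + f' x * indicator B x)"
        by (intro mean_mono) (auto simp: covered_def B_def f' split: split_indicator)
      with A B' show ?thesis by (simp add: mean_add)
    qed
    ultimately show ?thesis
      unfolding tame_def using f' by blast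
  qed
qed

section \<open>A linear lower bound for the primes from 23 on\<close>

text \<open>The number of integers in \<open>{0..<m}\<close> coprime to 30, if \<open>m\<close> itself is coprime to 30.\<close>
definition rank30 :: "nat \<Rightarrow> nat" where
  "rank30 m = 8 * (m div 30) + (\<Sum>r\<leftarrow>[1, 7, 11, 13, 17, 19, 23]. of_bool (r < m mod 30))"

lemma mod_30_cases:
  fixes m :: nat
  assumes "\<not> 2 dvd m" "\<not> 3 dvd m" "\<not> 5 dvd m"
  shows "m mod 30 \<in> {1, 7, 11, 13, 17, 19, 23, 29}"
proof -
  have "\<forall>r\<in>set [0..<30]. r mod 2 = 0 \<or> r mod 3 = 0 \<or> r mod 5 = 0
      \<or> r \<in> {1, 7, 11, 13, 17, 19, 23, 29 :: nat}"
    by code_simp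
  moreover have "m mod 30 \<in> set [0..<30]" by simp
  moreover have "m mod 30 mod 2 = m mod 2" "m mod 30 mod 3 = m mod 3" "m mod 30 mod 5 = m mod 5"
    by (simp_all add: mod_mod_cancel)
  ultimately show ?thesis
    using assms unfolding dvd_eq_mod_eq_0 by metis
qed

text \<open>The number \<open>m\<close> is itself counted in \<open>rank30 n\<close> but not in
  \<open>rank30 m\<close>.\<close>

lemma rank30_strict_mono:
  assumes "m < n" and m: "m mod 30 \<in> {1, 7, 11, 13, 17, 19, 23, 29}"
    and n: "n mod 30 \<in> {1, 7, 11, 13, 17, 19, 23, 29}"
  shows "rank30 m < rank30 n"
proof (cases "m div 30 = n div 30")
  case True
  with \<open>m < n\<close> have "m mod 30 < n mod 30"
    by (metis div_mult_mod_eq nat_add_left_cancel_less)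
  with m n have "(\<Sum>r\<leftarrow>[1, 7, 11, 13, 17, 19, 23]. of_bool (r < m mod 30))
      < (\<Sum>r\<leftarrow>[1, 7, 11, 13, 17, 19, 23]. of_bool (r < n mod 30) :: nat)"
    unfolding insert_iff empty_iff by (elim disjE) simp_all
  with True show ?thesis
    by (simp only: rank30_def add_less_cancel_left)
next
  case False
  with \<open>m < n\<close> have "m div 30 < n div 30"
    by (simp add: div_le_mono le_neq_implies_less)
  \<comment> \<open>Only seven residues are listed, as none modulo 30 exceeds 29; so a partial block
    stays below the 8 of a full one.\<close>
  moreover have "rank30 m < 8 * (m div 30) + 8" "8 * (n div 30) \<le> rank30 n"
    by (simp_all add: rank30_def of_bool_def)
  ultimately show ?thesis by linarith
qed

text \<open>The slope is the density \<open>8 / 30\<close>; equality holds at \<open>m = 19\<close>,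
  where the rank is 5.\<close>

lemma rank30_le:
  assumes "m mod 30 \<in> {1, 7, 11, 13, 17, 19, 23, 29}"
  shows "15 * rank30 m + 1 \<le> 4 * m"
proof -
  define s where "s = (\<Sum>r\<leftarrow>[1, 7, 11, 13, 17, 19, 23]. of_bool (r < m mod 30) :: nat)"
  have "15 * s + 1 \<le> 4 * (m mod 30)"
    using assms unfolding s_def insert_iff empty_iff by (elim disjE) simp_all
  moreover have "rank30 m = 8 * (m div 30) + s"
    by (simp only: rank30_def s_def)
  moreover have "m = 30 * (m div 30) + m mod 30" by simp
  ultimately show ?thesis by linarith
qed

definition large_prime :: "nat \<Rightarrow> nat" where
  "large_prime = Infinite_Set.enumerate {p. prime p \<and> 23 \<le> p}"

lemma infinite_large_primes: "infinite {p :: nat. prime p \<and> 23 \<le> p}"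
proof
  assume "finite {p :: nat. prime p \<and> 23 \<le> p}"
  then have "finite ({p :: nat. prime p \<and> 23 \<le> p} \<union> {..<23})" by simp
  then have "finite {p :: nat. prime p}"
    by (rule rev_finite_subset) auto
  with primes_infinite show False by simp
qed

lemma large_prime: "prime (large_prime k)" "23 \<le> large_prime k"
  using enumerate_in_set[OF infinite_large_primes, of k] by (auto simp: large_prime_def)

lemma strict_mono_large_prime: "strict_mono large_prime"
  unfolding large_prime_def by (rule strict_mono_enumerate[OF infinite_large_primes])

lemma ex_large_prime:
  assumes "prime p" "23 \<le> p"
  obtains k where "p = large_prime k" "k \<le> p"
proof -
  obtain k where k: "p = large_prime k"
    using enumerate_Ex[OF infinite_large_primes, of p] assms
    by (auto simp: large_prime_def)
  moreover have "k \<le> p"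
    using strict_mono_imp_increasing[OF strict_mono_large_prime] k by simp
  ultimately show thesis by (rule that)
qed

lemma large_prime_mod_30: "large_prime k mod 30 \<in> {1, 7, 11, 13, 17, 19, 23, 29}"
proof (rule mod_30_cases)
  have "\<not> d dvd large_prime k" if "d \<noteq> 1" "d < 23" for d
    using that large_prime[of k] by (auto simp: prime_nat_iff)
  from this[of 2] this[of 3] this[of 5]
  show "\<not> 2 dvd large_prime k" "\<not> 3 dvd large_prime k" "\<not> 5 dvd large_prime k"
    by simp_all
qed

text \<open>The rank of 23 is 6 and each further prime raises the rank by at least 1;
  \<open>15 * (k + 6) + 1 = 15 * k + 91\<close>.\<close>

lemma large_prime_ge: "15 * k + 91 \<le> 4 * large_prime k"
proof -
  have "k + 6 \<le> rank30 (large_prime k)"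
  proof (induction k)
    case 0
    have "rank30 23 \<le> rank30 (large_prime 0)"
      using rank30_strict_mono[of 23 "large_prime 0"] large_prime(2)[of 0] large_prime_mod_30[of 0]
      by (cases "large_prime 0 = 23") auto
    then show ?case by (simp add: rank30_def)
  next
    case (Suc k)
    have "rank30 (large_prime k) < rank30 (large_prime (Suc k))"
      by (intro rank30_strict_mono large_prime_mod_30 strict_monoD[OF strict_mono_large_prime]) simp
    with Suc show ?case by simp
  qed
  with rank30_le[OF large_prime_mod_30[of k]] show ?thesis by linarith
qed

section \<open>Numerical estimate of the total covered measure\<close>

text \<open>
  The constant \<open>29 / 5\<close> is chosen so that \<open>large_prime k - 1 \<ge> 15 / 4 * (k + 29 / 5)\<close>; the
  exponent of growth \<open>11 / 12\<close> exceeds \<open>10 / 9 * (3 + 2 / 22) * 4 / 15\<close>.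
\<close>
definition growth :: "nat \<Rightarrow> real" where
  "growth k = (\<Prod>j<k. 1 + (11 / 12) / (real j + 29 / 5))"

lemma growth_nonneg: "0 \<le> growth k"
  unfolding growth_def by (intro prod_nonneg) simp

text \<open>With \<open>x = k + 29 / 5\<close>, \<open>growth\<close> is of order
  \<open>x powr (11 / 12)\<close>, so the tail of the series is about
  \<open>12 * growth k / x\<close>, where \<open>12 = 1 / (1 - 11 / 12)\<close>. Replacing
  \<open>x\<close> by \<open>x - 1\<close> turns this into a telescoping majorant.\<close>

lemma growth_term_le:
  "growth k / (real k + 29 / 5)\<^sup>2
    \<le> 12 * growth k / (real k + 24 / 5) - 12 * growth (Suc k) / (real (Suc k) + 24 / 5)"
proof -
  define x where "x = real k + 29 / 5"
  have x: "1 < x" by (simp add: x_def)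
  have "1 / x\<^sup>2 \<le> (x + 11) / ((x - 1) * x\<^sup>2)"
    using x by (simp add: divide_simps)
  also have "\<dots> = 12 / (x - 1) - 12 * (1 + (11 / 12) / x) / x"
    using x by (simp add: field_simps power2_eq_square)
  finally have "growth k * (1 / x\<^sup>2) \<le> growth k * (12 / (x - 1) - 12 * (1 + (11 / 12) / x) / x)"
    by (rule mult_left_mono) (rule growth_nonneg)
  moreover have "growth (Suc k) = growth k * (1 + (11 / 12) / x)"
    by (simp add: growth_def x_def)
  moreover have "real k + 24 / 5 = x - 1" "real (Suc k) + 24 / 5 = x"
    by (auto simp: x_def)
  ultimately show ?thesis
    by (simp only: x_def[symmetric]) (simp add: algebra_simps)
qed

lemma growth_sum_le: "(\<Sum>k<n. growth k / (real k + 29 / 5)\<^sup>2) \<le> 5 / 2"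
proof -
  have "(\<Sum>k<n. growth k / (real k + 29 / 5)\<^sup>2)
      \<le> (\<Sum>k<n. 12 * growth k / (real k + 24 / 5) - 12 * growth (Suc k) / (real (Suc k) + 24 / 5))"
    by (intro sum_mono growth_term_le)
  also have "\<dots> = 12 * growth 0 / (real 0 + 24 / 5) - 12 * growth n / (real n + 24 / 5)"
    by (rule sum_lessThan_telescope')
  \<comment> \<open>Here \<open>growth 0 = 1\<close> and
    \<open>12 / (24 / 5) = 5 / 2\<close>.\<close>
  also have "\<dots> \<le> 5 / 2"
    using growth_nonneg[of n] by (simp add: growth_def)
  finally show ?thesis .
qed

text \<open>The moment bound that \<open>tame_step\<close> accumulates for
  \<open>\<delta> = 1 / 10\<close>, left unsimplified to match its instances literally.\<close>

definition weight :: "nat \<Rightarrow> real" where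
  "weight k = (\<Prod>j<k. 1 + ((3 * real (large_prime j) - 1) / (real (large_prime j) - 1)\<^sup>2) / (1 - 1 / 10))"

lemma large_prime_real_ge: "15 / 4 * (real k + 29 / 5) \<le> real (large_prime k) - 1"
proof -
  have "real (15 * k + 91) \<le> real (4 * large_prime k)"
    using large_prime_ge[of k] by (simp only: of_nat_le_iff)
  then show ?thesis by simp
qed

lemma weight_le_growth: "weight k \<le> growth k"
  unfolding weight_def growth_def
proof (intro prod_mono conjI add_left_mono)
  fix j
  define t x where "t = real (large_prime j) - 1" and "x = real j + 29 / 5"
  have t: "22 \<le> t" "15 / 4 * x \<le> t" and x: "0 < x"
    using large_prime(2)[of j] large_prime_real_ge[of j] by (auto simp: t_def x_def)
  have eq: "3 * real (large_prime j) - 1 = 3 * t + 2" by (simp add: t_def)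
  show "0 \<le> 1 + (3 * real (large_prime j) - 1) / (real (large_prime j) - 1)\<^sup>2 / (1 - 1 / 10)"
    unfolding eq using t by simp
  \<comment> \<open>From \<open>t \<ge> 22\<close> follows
    \<open>3 * t + 2 \<le> (3 + 2 / 22) * t = 34 / 11 * t\<close>.\<close>
  have "(3 * t + 2) / t\<^sup>2 \<le> (34 / 11 * t) / t\<^sup>2"
    using t by (intro divide_right_mono) auto
  also have "\<dots> = (34 / 11) / t"
    using t by (simp add: power2_eq_square)
  also have "\<dots> \<le> (34 / 11) / (15 / 4 * x)"
    using t x by (intro divide_left_mono) auto
  finally have "(3 * t + 2) / t\<^sup>2 / (1 - 1 / 10) \<le> (34 / 11) / (15 / 4 * x) / (1 - 1 / 10)"
    by (intro divide_right_mono) auto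
  \<comment> \<open>The constant on the left is \<open>272 / 297\<close>, just below
    \<open>11 / 12\<close>.\<close>
  also have "\<dots> \<le> (11 / 12) / x"
    using x by (simp add: field_simps)
  finally show "(3 * real (large_prime j) - 1) / (real (large_prime j) - 1)\<^sup>2 / (1 - 1 / 10)
      \<le> (11 / 12) / (real j + 29 / 5)"
    unfolding eq t_def x_def .
qed

lemma cost_less_1:
  "(\<Sum>k<n. weight k / ((real (large_prime k) - 1)\<^sup>2 * (4 * (1 / 10) * (1 - 1 / 10)))) < 1"
proof -
  have "(\<Sum>k<n. weight k / ((real (large_prime k) - 1)\<^sup>2 * (4 * (1 / 10) * (1 - 1 / 10))))
      \<le> (\<Sum>k<n. 16 / 81 * (growth k / (real k + 29 / 5)\<^sup>2))"
  proof (rule sum_mono)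
    fix k
    have "(15 / 4 * (real k + 29 / 5))\<^sup>2 \<le> (real (large_prime k) - 1)\<^sup>2"
      by (intro power_mono large_prime_real_ge) simp
    then have "weight k / ((real (large_prime k) - 1)\<^sup>2 * (4 * (1 / 10) * (1 - 1 / 10)))
        \<le> growth k / ((15 / 4 * (real k + 29 / 5))\<^sup>2 * (4 * (1 / 10) * (1 - 1 / 10)))"
      by (intro frac_le weight_le_growth growth_nonneg mult_right_mono) auto
    \<comment> \<open>The factor is \<open>(4 / 15)^2 / (9 / 25)\<close>; with the sum at most
      \<open>5 / 2\<close>, the total cost is at most \<open>40 / 81\<close>.\<close>
    also have "\<dots> = 16 / 81 * (growth k / (real k + 29 / 5)\<^sup>2)"
      unfolding power_mult_distrib by (simp add: power2_eq_square)
    finally show "weight k / ((real (large_prime k) - 1)\<^sup>2 * (4 * (1 / 10) * (1 - 1 / 10)))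
        \<le> 16 / 81 * (growth k / (real k + 29 / 5)\<^sup>2)" .
  qed
  also have "\<dots> = 16 / 81 * (\<Sum>k<n. growth k / (real k + 29 / 5)\<^sup>2)"
    by (simp only: sum_distrib_left)
  also have "\<dots> < 1"
    using growth_sum_le[of n] by simp
  finally show ?thesis .
qed


section \<open>A common multiple of the moduli, and the contradiction\<close>

lemma prime_factor_of_factorizes:
  assumes P: "\<forall>b\<in>P. prime b" and "factorizes P m" and q: "prime q" "q dvd m"
  shows "q \<in> P"
proof -
  obtain F e where F: "finite F" "F \<subseteq> P" "m = (\<Prod>b\<in>F. b ^ e b)"
    using \<open>factorizes P m\<close> unfolding factorizes_def by blast
  then obtain b where "b \<in> F" "q dvd b ^ e b"
    using q by (auto simp: prime_dvd_prod_iff)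
  then have "q dvd b"
    using q(1) prime_dvd_power by blast
  with P F(2) q(1) \<open>b \<in> F\<close> show ?thesis
    by (metis primes_dvd_imp_eq subsetD)
qed

text \<open>A prime factor \<open>q\<close> of \<open>m\<close> has index at most
  \<open>q \<le> N\<close>, and its exponent \<open>e\<close> satisfies
  \<open>2 ^ e \<le> m \<le> N\<close>, so \<open>N\<close> bounds both index and exponent.\<close>

lemma dvd_prod_large_prime_power:
  assumes "0 < m" "m \<le> N" and large: "\<And>q. prime q \<Longrightarrow> q dvd m \<Longrightarrow> 23 \<le> q"
  shows "m dvd (\<Prod>k<Suc N. large_prime k ^ N)"
proof -
  have "m = (\<Prod>q\<in>prime_factors m. q ^ multiplicity q m)"
    using \<open>0 < m\<close> by (simp add: prime_factorization_nat)
  also have "\<dots> dvd (\<Prod>q\<in>prime_factors m. q ^ N)"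
  proof (rule prod_dvd_prod, rule le_imp_power_dvd)
    fix q assume q: "q \<in> prime_factors m"
    then have "2 ^ multiplicity q m \<le> q ^ multiplicity q m"
      by (intro power_mono) (auto simp: prime_ge_2_nat in_prime_factors_iff)
    also have "\<dots> \<le> m"
      using \<open>0 < m\<close> by (intro dvd_imp_le multiplicity_dvd)
    finally show "multiplicity q m \<le> N"
      using \<open>m \<le> N\<close> less_exp[of "multiplicity q m"] by linarith
  qed
  also have "\<dots> dvd (\<Prod>q\<in>large_prime ` {..<Suc N}. q ^ N)"
  proof (rule prod_dvd_prod_subset)
    show "prime_factors m \<subseteq> large_prime ` {..<Suc N}"
    proof
      fix q assume "q \<in> prime_factors m"
      then have q: "prime q" "q dvd m" by auto
      then obtain k where "q = large_prime k" "k \<le> q"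
        using ex_large_prime large by blast
      moreover have "q \<le> N"
        using q dvd_imp_le \<open>0 < m\<close> \<open>m \<le> N\<close> order_trans by blast
      ultimately show "q \<in> large_prime ` {..<Suc N}" by auto
    qed
  qed simp
  also have "\<dots> = (\<Prod>k<Suc N. large_prime k ^ N)"
    using strict_mono_large_prime
    by (subst prod.reindex) (auto intro: inj_on_subset strict_mono_imp_inj_on)
  finally show ?thesis .
qed

lemma tame_large_primes:
  assumes "1 \<notin> S"
  shows "tame S a (\<Prod>k<n. large_prime k ^ \<gamma>) (weight n)
    (\<Sum>k<n. weight k / ((real (large_prime k) - 1)\<^sup>2 * (4 * (1 / 10) * (1 - 1 / 10))))"
proof (induction n)
  case 0
  then show ?case using tame_1[OF assms] by (simp add: weight_def)
next
  case (Suc n)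
  have "coprime (large_prime k) (large_prime n)" if "k < n" for k
    using that strict_monoD[OF strict_mono_large_prime, of k n]
    by (intro primes_coprime large_prime) auto
  then have "coprime (\<Prod>k<n. large_prime k ^ \<gamma>) (large_prime n)"
    by (intro prod_coprime_left) simp
  moreover have "0 < (\<Prod>k<n. large_prime k ^ \<gamma>)"
    using large_prime(1) by (intro prod_pos) (simp add: prime_gt_0_nat)
  ultimately have "tame S a ((\<Prod>k<n. large_prime k ^ \<gamma>) * large_prime n ^ \<gamma>)
      (weight n * (1 + ((3 * real (large_prime n) - 1) / (real (large_prime n) - 1)\<^sup>2) / (1 - 1 / 10)))
      ((\<Sum>k<n. weight k / ((real (large_prime k) - 1)\<^sup>2 * (4 * (1 / 10) * (1 - 1 / 10))))
        + weight n / ((real (large_prime n) - 1)\<^sup>2 * (4 * (1 / 10) * (1 - 1 / 10))))"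
    by (intro tame_step Suc large_prime) auto
  then show ?case
    unfolding weight_def prod.lessThan_Suc sum.lessThan_Suc .
qed

theorem theorem3:
  fixes q0 :: real
  assumes "q0 \<ge> 19"
  shows "\<not> factorizes_covering {p :: nat. prime p \<and> real p > q0}"
proof
  let ?P = "{p :: nat. prime p \<and> real p > q0}"
  assume "factorizes_covering ?P"
  then obtain S a where fin: "finite S" and gt1: "\<forall>m\<in>S. 1 < m"
    and cover: "(\<Union>m\<in>S. residue_class (a m) m) = UNIV" and fact: "\<forall>m\<in>S. factorizes ?P m"
    unfolding factorizes_covering_def covering_system_def residue_system_def by blast
  have ge23: "23 \<le> q" if "prime q" "q dvd m" "m \<in> S" for q m
  proof -
    have "q \<in> ?P"
      by (rule prime_factor_of_factorizes[of _ m]) (use that fact in auto)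
    then have "19 < q" using assms by simp
    moreover have "q \<noteq> 20" "q \<noteq> 21" "q \<noteq> 22"
      using \<open>prime q\<close> by (auto simp: prime_nat_numeral_eq)
    ultimately show ?thesis by linarith
  qed
  \<comment> \<open>The sum serves as an upper bound for all moduli.\<close>
  define N where "N = \<Sum>S"
  let ?Q = "\<Prod>k<Suc N. large_prime k ^ N"
  have "m dvd ?Q" if "m \<in> S" for m
  proof (rule dvd_prod_large_prime_power)
    show "m \<le> N" unfolding N_def using fin that by (intro member_le_sum) auto
  qed (use that gt1 ge23 in auto)
  then have "{m \<in> S. m dvd ?Q} = S" by blast
  then have "covered S a ?Q = UNIV"
    unfolding covered_def using cover by (simp only:)
  moreover have "1 \<notin> S" using gt1 by auto
  \<comment> \<open>The covered set is everything, so its measure is the total mass 1 of the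
    density.\<close>
  ultimately have "1 \<le> (\<Sum>k<Suc N. weight k / ((real (large_prime k) - 1)\<^sup>2 * (4 * (1 / 10) * (1 - 1 / 10))))"
    using tame_large_primes[of S a N "Suc N"] unfolding tame_def by auto
  with cost_less_1[of "Suc N"] show False by linarith
qed

end
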